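(* Let $X\subseteq\mathbb R^n$ be a nonempty closed convex set and let $F:X\to\mathbb R^n$, $F(x)=\mathbb E[G(x,\xi)]$, be a continuous map that is co-coercive on $X$, i.e. there exists $\mu>0$ such that $\langle F(x)-F(y),x-y\rangle\ge\mu\|F(x)-F(y)\|^2$ for all $x,y\in X$. Let $x^*$ be a solution of the stochastic inverse variational inequality (SIVI) problem. Let $\{x_k\}_{k\ge0}$ be the iterates generated by the VR-IPG method, and suppose there exists $\nu>0$ such that $\mathbb E[\bar w_{k,N_k}\mid\mathcal F_k]=0$ and $\mathbb E[\|\bar w_{k,N_k}\|^2\mid\mathcal F_k]\le\frac{\nu^2}{N_k}$ hold almost surely for all $k$. Choose $\eta_k=\eta\ge\frac1{2\mu}$ and let $N_k=\lceil(k+1)^{2+2\delta}\rceil$ for all $k\ge0$, where $\delta>0$. Then $$\min_{k\in\{0,\dots,T-1\}}\mathbb E\big[\|H(x_k,\eta)\|^2\big]\le\frac{1}{T\left(1-\frac1{2\eta\mu}\right)}\left[\|x_0-x^*\|^2+\frac{\pi^2\nu^2}{\eta^2}+\frac{2\nu\|x^*\|}{\eta}\Big(1+\frac1\delta\Big)\right]=\mathcal O(1/T).$$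
   Context: Setting: $(\Omega,\mathcal F,\mathbb P)$ is a probability space, $\xi:\Omega\to\mathbb R^d$ is a random vector, $G:X\times\mathbb R^d\to\mathbb R^n$, and $F(x)=\mathbb E[G(x,\xi)]$. $\|\cdot\|$ is the Euclidean norm and $\mathbf P_X[u]=\mathrm{argmin}_{z\in X}\|z-u\|$ is the projection of $u$ onto $X$. SIVI problem: find $x^*\in\mathbb R^n$ such that $F(x^* )\in X$ and $\langle y-F(x^* ),x^*\rangle\ge0$ for all $y\in X$. Such an $x^*$ is called a solution. Gap function: $H:X\times\mathbb R_+\to\mathbb R^n$, $H(x,\eta)=\frac1\eta\big(F(x)-\mathbf P_X(F(x)-\eta x)\big)$. VR-IPG method (variance-reduced inverse projected gradient): given $x_0\in X$ and $\{\eta_k,N_k\}_{k\ge0}\subseteq\mathbb R_+$ (where $N_k$ is the batch size at iteration $k$), and samples $\xi_{j,k}$ ($1\le j\le N_k$) of $\xi$, for $k=0,\dots,T-1$ ($T$ being the number of iterations) set $$z_k=\mathbf P_X\Big[\tfrac1{N_k}\sum_{j=1}^{N_k}G(x_k,\xi_{j,k})-\eta_kx_k\Big],\qquad x_{k+1}=x_k-\tfrac1{\eta_k}\Big(\tfrac1{N_k}\sum_{j=1}^{N_k}G(x_k,\xi_{j,k})-z_k\Big).$$ Sampling error: $\bar w_{k,N_k}=\frac1{N_k}\sum_{j=1}^{N_k}\big(G(x_k,\xi_{j,k})-F(x_k)\big)$. Information history at epoch $k$: $\mathcal F_k=\sigma\{x_0,x_1,\dots,x_{k-1}\}$.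
   Formalization: Since G and F are defined only on X while the update can leave X, it is additionally assumed that the solution x* lies in X and that all iterates x_k stay in X; otherwise F(x* ) or G(x_k,·) would be undefined. *)

theory Defs
  imports "HOL-Probability.Probability" "HOL-Library.Landau_Symbols"
begin

definition cocoercive_on :: "'a::real_inner set \<Rightarrow> ('a \<Rightarrow> 'a) \<Rightarrow> real \<Rightarrow> bool" where
  "cocoercive_on X F \<mu> \<longleftrightarrow>
     \<mu> > 0 \<and> (\<forall>x\<in>X. \<forall>y\<in>X. (F x - F y) \<bullet> (x - y) \<ge> \<mu> * (norm (F x - F y))\<^sup>2)"

definition sivi_solution :: "'a::real_inner set \<Rightarrow> ('a \<Rightarrow> 'a) \<Rightarrow> 'a \<Rightarrow> bool" where
  "sivi_solution X F x \<longleftrightarrow> F x \<in> X \<and> (\<forall>y\<in>X. (y - F x) \<bullet> x \<ge> 0)"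

definition gap :: "'a::euclidean_space set \<Rightarrow> ('a \<Rightarrow> 'a) \<Rightarrow> 'a \<Rightarrow> real \<Rightarrow> 'a" where
  "gap X F x \<eta> = (1 / \<eta>) *\<^sub>R (F x - closest_point X (F x - \<eta> *\<^sub>R x))"

text \<open>Throughout, \<open>s j k \<omega>\<close> is the \<open>j\<close>-th sample drawn in iteration \<open>k\<close>.\<close>

definition batch_mean ::
  "('a::real_vector \<Rightarrow> 'b \<Rightarrow> 'a) \<Rightarrow> (nat \<Rightarrow> nat) \<Rightarrow> (nat \<Rightarrow> nat \<Rightarrow> 'w \<Rightarrow> 'b) \<Rightarrow> nat \<Rightarrow> 'a \<Rightarrow> 'w \<Rightarrow> 'a" where
  "batch_mean G N s k x \<omega> = (1 / real (N k)) *\<^sub>R (\<Sum>j = 1..N k. G x (s j k \<omega>))"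

primrec vr_ipg ::
  "'a::euclidean_space set \<Rightarrow> ('a \<Rightarrow> 'b \<Rightarrow> 'a) \<Rightarrow> (nat \<Rightarrow> real) \<Rightarrow> (nat \<Rightarrow> nat)
    \<Rightarrow> (nat \<Rightarrow> nat \<Rightarrow> 'w \<Rightarrow> 'b) \<Rightarrow> 'a \<Rightarrow> nat \<Rightarrow> 'w \<Rightarrow> 'a" where
  "vr_ipg X G \<eta> N s x0 0 \<omega> = x0"
| "vr_ipg X G \<eta> N s x0 (Suc k) \<omega> =
     (let x = vr_ipg X G \<eta> N s x0 k \<omega>;
          g = batch_mean G N s k x \<omega>;
          z = closest_point X (g - \<eta> k *\<^sub>R x)
      in x - (1 / \<eta> k) *\<^sub>R (g - z))"

definition sampling_error ::
  "('a::real_vector \<Rightarrow> 'a) \<Rightarrow> ('a \<Rightarrow> 'b \<Rightarrow> 'a) \<Rightarrow> (nat \<Rightarrow> nat) \<Rightarrow> (nat \<Rightarrow> nat \<Rightarrow> 'w \<Rightarrow> 'b)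
    \<Rightarrow> (nat \<Rightarrow> 'w \<Rightarrow> 'a) \<Rightarrow> nat \<Rightarrow> 'w \<Rightarrow> 'a" where
  "sampling_error F G N s x k \<omega> =
     (1 / real (N k)) *\<^sub>R (\<Sum>j = 1..N k. G (x k \<omega>) (s j k \<omega>) - F (x k \<omega>))"

text \<open>The sigma-algebra generated by \<open>x 0, \<dots>, x (k - 1)\<close>; it does not include \<open>x k\<close>, and it
  is trivial for \<open>k = 0\<close>.\<close>

definition history :: "'w measure \<Rightarrow> (nat \<Rightarrow> 'w \<Rightarrow> 'a::topological_space) \<Rightarrow> nat \<Rightarrow> 'w measure" where
  "history M x k = sigma (space M) {x i -` A \<inter> space M | i A. i < k \<and> A \<in> sets borel}"

text \<open>The library's conditional expectation is for real-valued functions; this is its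
  coordinatewise extension.\<close>

definition vec_cond_exp ::
  "'w measure \<Rightarrow> 'w measure \<Rightarrow> ('w \<Rightarrow> 'a::euclidean_space) \<Rightarrow> 'w \<Rightarrow> 'a" where
  "vec_cond_exp M \<F> f \<omega> = (\<Sum>b\<in>Basis. real_cond_exp M \<F> (\<lambda>\<omega>. f \<omega> \<bullet> b) \<omega> *\<^sub>R b)"

text \<open>The expectation of the squared norm of the gap, as an extended nonnegative number, so that
  a non-integrable gap would have expectation \<open>\<infinity>\<close> rather than \<open>0\<close>.\<close>

definition expected_sq_gap ::
  "'w measure \<Rightarrow> 'a::euclidean_space set \<Rightarrow> ('a \<Rightarrow> 'a) \<Rightarrow> ('w \<Rightarrow> 'a) \<Rightarrow> real \<Rightarrow> ennreal" where
  "expected_sq_gap M X F x \<eta> = (\<integral>\<^sup>+ \<omega>. ennreal ((norm (gap X F (x \<omega>) \<eta>))\<^sup>2) \<partial>M)"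

end

theory Submission
  imports Defs
begin

text \<open>The noisy step maps \<open>y\<close> to a multiple of the projection residual of \<open>F y + w - \<eta> y\<close>. Its
  squared norm is a squared distance to \<open>X\<close>, so in \<open>\<parallel>x (k + 1) - xstar\<parallel>\<^sup>2\<close> the noise enters through
  a linear term, a quadratic term and a Lipschitz term with factor \<open>\<parallel>xstar\<parallel>\<close>; the noiseless part
  decreases by a multiple of \<open>\<parallel>H\<parallel>\<^sup>2\<close> by co-coercivity. The history at \<open>k\<close> does not contain \<open>x k\<close>, so
  the linear term need not have mean zero, but the noiseless step is nonexpansive: replacing \<open>x k\<close> by
  the noiseless image of \<open>x (k - 1)\<close> makes it so, at a cost of second order in the noise. The
  quadratic terms add up to at most \<open>3 \<nu>\<^sup>2 / \<eta>\<^sup>2 (\<Sum>k. 1 / (k + 1)\<^sup>2)\<close>, which is within the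
  bound \<open>\<pi>\<^sup>2 \<nu>\<^sup>2 / \<eta>\<^sup>2\<close>.\<close>

section \<open>Projection residuals\<close>

lemma norm_closest_point_residual_diff_le:
  fixes X :: "'a::euclidean_space set"
  assumes "convex X" "closed X" "X \<noteq> {}"
  shows "norm ((closest_point X a - a) - (closest_point X b - b)) \<le> norm (a - b)"
proof (rule power2_le_imp_le)
  define p q where "p = closest_point X a" and "q = closest_point X b"
  \<comment> \<open>The obtuse-angle inequalities of the two projections, each tested at the other
    projection; their sum is firm nonexpansiveness, which is stronger than the claim by
    \<open>(norm (p - q))\<^sup>2\<close>.\<close>
  have "(a - p) \<bullet> (q - p) \<le> 0" "(b - q) \<bullet> (p - q) \<le> 0"
    using assms unfolding p_def q_def
    by (auto intro!: closest_point_dot closest_point_in_set)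
  then have "(norm ((p - a) - (q - b)))\<^sup>2 + (norm (p - q))\<^sup>2 \<le> (norm (a - b))\<^sup>2"
    by (simp add: power2_norm_eq_inner inner_diff_left inner_diff_right inner_commute)
  then show "(norm ((closest_point X a - a) - (closest_point X b - b)))\<^sup>2 \<le> (norm (a - b))\<^sup>2"
    using zero_le_power2[of "norm (p - q)"] unfolding p_def q_def by linarith
qed simp

section \<open>Deterministic analysis of a single step\<close>

locale inverse_vi =
  fixes X :: "'a::euclidean_space set" and F :: "'a \<Rightarrow> 'a" and \<mu> \<eta> :: real and xstar :: 'a
  assumes convex: "convex X" and closed: "closed X"
    and cont: "continuous_on X F"
    and cocoercive: "cocoercive_on X F \<mu>"
    and xstar: "xstar \<in> X" "sivi_solution X F xstar"
    and step: "\<eta> \<ge> 1 / (2 * \<mu>)"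
begin

text \<open>The second argument is the sampling error: \<open>F y + w\<close> stands for the batch
  mean, and \<open>w = 0\<close> gives the exact step.\<close>

definition ipg_step :: "'a \<Rightarrow> 'a \<Rightarrow> 'a" where
  "ipg_step y w = y - (1 / \<eta>) *\<^sub>R (F y + w - closest_point X (F y + w - \<eta> *\<^sub>R y))"

lemma nonempty: "X \<noteq> {}"
  using xstar by auto

lemma mu_pos: "\<mu> > 0"
  using cocoercive by (simp add: cocoercive_on_def)

lemma eta_pos: "\<eta> > 0"
  using step mu_pos by (smt (verit) zero_less_divide_1_iff)

lemma ipg_step_residual:
  "ipg_step y w = (1 / \<eta>) *\<^sub>R (closest_point X (F y + w - \<eta> *\<^sub>R y) - (F y + w - \<eta> *\<^sub>R y))"
  using eta_pos by (simp add: ipg_step_def algebra_simps)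

lemma ipg_step_0: "ipg_step y 0 = y - gap X F y \<eta>"
  by (simp add: ipg_step_def gap_def)

lemma norm_ipg_step_diff_le:
  "norm (ipg_step y w - ipg_step y' w')
     \<le> norm ((F y + w - \<eta> *\<^sub>R y) - (F y' + w' - \<eta> *\<^sub>R y')) / \<eta>"
proof -
  have "ipg_step y w - ipg_step y' w' = (1 / \<eta>) *\<^sub>R
     ((closest_point X (F y + w - \<eta> *\<^sub>R y) - (F y + w - \<eta> *\<^sub>R y))
      - (closest_point X (F y' + w' - \<eta> *\<^sub>R y') - (F y' + w' - \<eta> *\<^sub>R y')))"
    unfolding ipg_step_residual by (simp only: scaleR_diff_right)
  then show ?thesis
    using norm_closest_point_residual_diff_le[OF convex closed nonempty] eta_pos
    by (simp add: divide_right_mono)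
qed

lemma norm_ipg_step_noise_diff_le: "norm (ipg_step y w - ipg_step y 0) \<le> norm w / \<eta>"
  using norm_ipg_step_diff_le[of y w y 0] by (simp add: algebra_simps)

text \<open>Co-coercivity and \<open>\<eta> \<ge> 1 / (2 * \<mu>)\<close> make
  \<open>F y - \<eta> *\<^sub>R y\<close> Lipschitz with constant \<open>\<eta>\<close>: the cross
  term \<open>2 * \<eta> * (d \<bullet> e)\<close> absorbs \<open>(norm d)\<^sup>2\<close>. The
  factor \<open>1 / \<eta>\<close> of the residual then cancels the constant.\<close>

lemma ipg_step_0_nonexpansive:
  assumes "y \<in> X" "y' \<in> X"
  shows "norm (ipg_step y 0 - ipg_step y' 0) \<le> norm (y - y')"
proof -
  define d e where "d = F y - F y'" and "e = y - y'"
  have "\<mu> * (norm d)\<^sup>2 \<le> d \<bullet> e"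
    using cocoercive assms by (simp add: cocoercive_on_def d_def e_def)
  then have "2 * \<eta> * (\<mu> * (norm d)\<^sup>2) \<le> 2 * \<eta> * (d \<bullet> e)"
    using eta_pos by (intro mult_left_mono) auto
  moreover have "(norm d)\<^sup>2 \<le> 2 * \<eta> * (\<mu> * (norm d)\<^sup>2)"
    using step mu_pos mult_right_mono[of 1 "2 * \<eta> * \<mu>" "(norm d)\<^sup>2"]
    by (simp add: field_simps)
  moreover have "(norm (d - \<eta> *\<^sub>R e))\<^sup>2 = (norm d)\<^sup>2 - 2 * \<eta> * (d \<bullet> e) + \<eta>\<^sup>2 * (norm e)\<^sup>2"
    unfolding power2_norm_eq_inner
    by (simp add: inner_diff_left inner_diff_right inner_commute algebra_simps power2_eq_square)
  ultimately have "(norm (d - \<eta> *\<^sub>R e))\<^sup>2 \<le> (\<eta> * norm e)\<^sup>2"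
    by (simp add: power_mult_distrib)
  then have "norm (d - \<eta> *\<^sub>R e) \<le> \<eta> * norm e"
    by (rule power2_le_imp_le) (use eta_pos in simp)
  moreover have "(F y + 0 - \<eta> *\<^sub>R y) - (F y' + 0 - \<eta> *\<^sub>R y') = d - \<eta> *\<^sub>R e"
    by (simp add: d_def e_def algebra_simps)
  ultimately have "norm (ipg_step y 0 - ipg_step y' 0) \<le> \<eta> * norm e / \<eta>"
    using norm_ipg_step_diff_le[of y 0 y' 0] eta_pos
    by (metis divide_right_mono less_imp_le order_trans)
  then show ?thesis
    using eta_pos by (simp add: e_def)
qed

lemma ipg_step_0_descent:
  assumes "y \<in> X"
  shows "(norm (ipg_step y 0 - xstar))\<^sup>2 + (1 - 1 / (2 * \<eta> * \<mu>)) * (norm (gap X F y \<eta>))\<^sup>2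
           \<le> (norm (y - xstar))\<^sup>2"
proof -
  define v h d e where "v = F y - \<eta> *\<^sub>R y" and "h = gap X F y \<eta>"
    and "d = F y - F xstar" and "e = y - xstar"
  define z where "z = closest_point X v"
  have z: "z = F y - \<eta> *\<^sub>R h"
    using eta_pos by (simp add: z_def h_def gap_def v_def)
  \<comment> \<open>The projection inequality is tested at \<open>F xstar\<close>, a point of
    \<open>X\<close>; the solution inequality below is tested at the projected point
    \<open>z\<close>. Together they eliminate \<open>z\<close>.\<close>
  have "(v - z) \<bullet> (F xstar - z) \<le> 0"
    unfolding z_def using xstar
    by (intro closest_point_dot convex closed) (simp add: sivi_solution_def)
  moreover have "v - z = - \<eta> *\<^sub>R (y - h)"
    by (simp add: z v_def algebra_simps)
  ultimately have "\<eta> * ((y - h) \<bullet> (z - F xstar)) \<le> 0"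
    by (simp add: inner_diff_right algebra_simps)
  then have "(y - h) \<bullet> (z - F xstar) \<le> 0"
    using eta_pos by (simp add: mult_le_0_iff)
  moreover have "xstar \<bullet> (z - F xstar) \<ge> 0"
    using xstar nonempty closed
    by (simp add: sivi_solution_def z_def closest_point_in_set inner_commute)
  moreover have "z - F xstar = d - \<eta> *\<^sub>R h"
    by (simp add: z d_def)
  ultimately have "(e - h) \<bullet> (d - \<eta> *\<^sub>R h) \<le> 0"
    by (simp add: e_def inner_diff_left)
  then have eh: "d \<bullet> e - h \<bullet> d + \<eta> * (norm h)\<^sup>2 \<le> \<eta> * (e \<bullet> h)"
    by (simp add: power2_norm_eq_inner inner_diff_left inner_diff_right inner_commute algebra_simps)
  have de: "\<mu> * (norm d)\<^sup>2 \<le> d \<bullet> e"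
    using cocoercive assms xstar by (simp add: cocoercive_on_def d_def e_def)
  \<comment> \<open>Completing the square: the weight \<open>2 * \<mu>\<close> lets the co-coercive
    gain \<open>\<mu> * (norm d)\<^sup>2\<close> pay for \<open>h \<bullet> d\<close> up to
    \<open>(norm h)\<^sup>2 / (4 * \<mu>)\<close>, the source of the loss
    \<open>1 / (2 * \<eta> * \<mu>)\<close>.\<close>
  have "0 \<le> (norm ((2 * \<mu>) *\<^sub>R d - h))\<^sup>2"
    by simp
  also have "\<dots> = 4 * \<mu> * (\<mu> * (norm d)\<^sup>2 - h \<bullet> d) + (norm h)\<^sup>2"
    by (simp add: power2_norm_eq_inner inner_diff_left inner_diff_right inner_commute algebra_simps)
  finally have "\<mu> * (norm d)\<^sup>2 - h \<bullet> d \<ge> - ((norm h)\<^sup>2 / (4 * \<mu>))"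
    using mu_pos by (simp add: field_simps)
  with eh de have "\<eta> * (norm h)\<^sup>2 - (norm h)\<^sup>2 / (4 * \<mu>) \<le> \<eta> * (e \<bullet> h)"
    by linarith
  then have "2 / \<eta> * (\<eta> * (norm h)\<^sup>2 - (norm h)\<^sup>2 / (4 * \<mu>)) \<le> 2 / \<eta> * (\<eta> * (e \<bullet> h))"
    using eta_pos by (intro mult_left_mono) auto
  then have "2 * (norm h)\<^sup>2 - 1 / (2 * \<eta> * \<mu>) * (norm h)\<^sup>2 \<le> 2 * (e \<bullet> h)"
    using eta_pos mu_pos by (simp add: algebra_simps)
  moreover have "(norm (e - h))\<^sup>2 = (norm e)\<^sup>2 - 2 * (e \<bullet> h) + (norm h)\<^sup>2"
    by (simp add: power2_norm_eq_inner inner_diff_left inner_diff_right inner_commute)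
  moreover have "ipg_step y 0 - xstar = e - h"
    by (simp add: ipg_step_0 e_def h_def)
  ultimately show ?thesis
    by (simp only: left_diff_distrib flip: e_def h_def)
qed

text \<open>The squared norm of the residual \<open>u - closest_point X u\<close> is the squared distance to \<open>X\<close>,
  whose first-order expansion has a quadratic error, although the residual itself is only
  Lipschitz; the latter costs the term \<open>2 * norm xstar * norm w / \<eta>\<close>.\<close>

lemma ipg_step_descent:
  assumes "y \<in> X"
  shows "(norm (ipg_step y w - xstar))\<^sup>2 + (1 - 1 / (2 * \<eta> * \<mu>)) * (norm (gap X F y \<eta>))\<^sup>2
           \<le> (norm (y - xstar))\<^sup>2 - 2 / \<eta> * (ipg_step y 0 \<bullet> w) + (norm w)\<^sup>2 / \<eta>\<^sup>2
             + 2 * norm xstar * norm w / \<eta>"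
proof -
  define v where "v = F y - \<eta> *\<^sub>R y"
  define p q where "p = ipg_step y 0" and "q = ipg_step y w"
  have q: "q = (1 / \<eta>) *\<^sub>R (closest_point X (v + w) - (v + w))"
    by (simp add: q_def ipg_step_residual v_def algebra_simps)
  have p: "p = (1 / \<eta>) *\<^sub>R (closest_point X v - v)"
    by (simp add: p_def ipg_step_residual v_def algebra_simps)
  \<comment> \<open>The projection of \<open>v\<close> is a feasible competitor for that of
    \<open>v + w\<close>; this bounds \<open>norm q\<close> by the norm of an affine function of
    \<open>w\<close>.\<close>
  have "norm (closest_point X (v + w) - (v + w)) \<le> norm (closest_point X v - (v + w))"
    using closest_point_le[OF closed closest_point_in_set[OF closed nonempty], of "v + w" v]
    by (simp add: dist_norm norm_minus_commute)
  then have "norm q \<le> norm (closest_point X v - (v + w)) / \<eta>"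
    using eta_pos by (simp add: q divide_right_mono)
  also have "\<dots> = norm ((1 / \<eta>) *\<^sub>R (closest_point X v - (v + w)))"
    using eta_pos by simp
  also have "(1 / \<eta>) *\<^sub>R (closest_point X v - (v + w)) = p - (1 / \<eta>) *\<^sub>R w"
    by (simp add: p algebra_simps)
  finally have "(norm q)\<^sup>2 \<le> (norm (p - (1 / \<eta>) *\<^sub>R w))\<^sup>2"
    by (simp add: power_mono)
  also have "\<dots> = (norm p)\<^sup>2 - 2 / \<eta> * (p \<bullet> w) + (norm w)\<^sup>2 / \<eta>\<^sup>2"
    unfolding power2_norm_eq_inner
    by (simp add: inner_diff_left inner_diff_right inner_commute power2_eq_square)
  finally have "(norm q)\<^sup>2 \<le> (norm p)\<^sup>2 - 2 / \<eta> * (p \<bullet> w) + (norm w)\<^sup>2 / \<eta>\<^sup>2" .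
  moreover have "- ((q - p) \<bullet> xstar) \<le> norm w / \<eta> * norm xstar"
  proof -
    have "- ((q - p) \<bullet> xstar) \<le> norm (q - p) * norm xstar"
      using Cauchy_Schwarz_ineq2[of "q - p" xstar] by linarith
    also have "\<dots> \<le> norm w / \<eta> * norm xstar"
      unfolding p_def q_def by (intro mult_right_mono norm_ipg_step_noise_diff_le) simp
    finally show ?thesis .
  qed
  \<comment> \<open>Here \<open>q\<close> enters only through its norm, which has the sharp
    expansion, and through \<open>(q - p) \<bullet> xstar\<close>, where the Lipschitz bound
    suffices.\<close>
  moreover have "(norm (q - xstar))\<^sup>2 = (norm q)\<^sup>2 - (norm p)\<^sup>2 - 2 * ((q - p) \<bullet> xstar)
      + (norm (p - xstar))\<^sup>2"
    by (simp add: power2_norm_eq_inner inner_diff_left inner_diff_right inner_commute)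
  ultimately show ?thesis
    using ipg_step_0_descent[OF assms] by (simp add: p_def q_def algebra_simps)
qed

text \<open>The exact step can leave \<open>X\<close>, yet its image is stepped again below.
  Projecting first gives a map that is nonexpansive, hence Borel, on the whole space.\<close>

definition ext_step :: "'a \<Rightarrow> 'a" where
  "ext_step y = ipg_step (closest_point X y) 0"

lemma ext_step_eq: "y \<in> X \<Longrightarrow> ext_step y = ipg_step y 0"
  by (simp add: ext_step_def closest_point_self)

lemma ext_step_nonexpansive: "norm (ext_step y - ext_step y') \<le> norm (y - y')"
proof -
  have "norm (ext_step y - ext_step y') \<le> norm (closest_point X y - closest_point X y')"
    unfolding ext_step_def
    by (intro ipg_step_0_nonexpansive closest_point_in_set closed nonempty)
  also have "\<dots> \<le> norm (y - y')"
    using closest_point_lipschitz[OF convex closed nonempty, of y y'] by (simp add: dist_norm)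
  finally show ?thesis .
qed

lemma borel_measurable_ext_step [measurable]: "ext_step \<in> borel_measurable borel"
proof (rule borel_measurable_continuous_onI)
  have "1-lipschitz_on UNIV ext_step"
    by (rule lipschitz_onI) (auto simp: dist_norm ext_step_nonexpansive)
  then show "continuous_on UNIV ext_step"
    by (rule lipschitz_on_continuous_on)
qed

lemma borel_measurable_closest_point [measurable]: "closest_point X \<in> borel_measurable borel"
  by (intro borel_measurable_continuous_onI continuous_on_closest_point convex closed nonempty)

text \<open>Continuity of \<open>F\<close> is assumed on \<open>X\<close> alone; composing with the
  projection gives a Borel map that agrees with \<open>F\<close> at the iterates.\<close>

lemma borel_measurable_F [measurable]: "(\<lambda>y. F (closest_point X y)) \<in> borel_measurable borel"
  by (intro borel_measurable_continuous_onI continuous_on_compose2[OF cont]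
        continuous_on_closest_point convex closed nonempty)
     (auto intro!: closest_point_in_set closed nonempty)

end

section \<open>Square integrability and conditional expectations\<close>

lemma abs_inner_le_half_sum_sq: "\<bar>a \<bullet> b\<bar> \<le> ((norm a)\<^sup>2 + (norm b)\<^sup>2) / 2"
  using Cauchy_Schwarz_ineq2[of a b] sum_squares_bound[of "norm a" "norm b"] by simp

lemma integrable_inner_square:
  fixes f g :: "'w \<Rightarrow> 'a::euclidean_space"
  assumes [measurable]: "f \<in> borel_measurable M" "g \<in> borel_measurable M"
    and "integrable M (\<lambda>\<omega>. (norm (f \<omega>))\<^sup>2)" "integrable M (\<lambda>\<omega>. (norm (g \<omega>))\<^sup>2)"
  shows "integrable M (\<lambda>\<omega>. f \<omega> \<bullet> g \<omega>)"
proof (rule Bochner_Integration.integrable_bound)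
  show "integrable M (\<lambda>\<omega>. ((norm (f \<omega>))\<^sup>2 + (norm (g \<omega>))\<^sup>2) / 2)"
    using assms by simp
  show "AE \<omega> in M. norm (f \<omega> \<bullet> g \<omega>) \<le> norm (((norm (f \<omega>))\<^sup>2 + (norm (g \<omega>))\<^sup>2) / 2)"
    using abs_inner_le_half_sum_sq by (intro AE_I2) auto
qed simp

lemma integrable_square_norm_add:
  fixes f g :: "'w \<Rightarrow> 'a::euclidean_space"
  assumes [measurable]: "f \<in> borel_measurable M" "g \<in> borel_measurable M"
    and "integrable M (\<lambda>\<omega>. (norm (f \<omega>))\<^sup>2)" "integrable M (\<lambda>\<omega>. (norm (g \<omega>))\<^sup>2)"
  shows "integrable M (\<lambda>\<omega>. (norm (f \<omega> + g \<omega>))\<^sup>2)"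
proof -
  have "integrable M (\<lambda>\<omega>. (norm (f \<omega>))\<^sup>2 + 2 * (f \<omega> \<bullet> g \<omega>) + (norm (g \<omega>))\<^sup>2)"
    using assms integrable_inner_square[OF assms] by simp
  then show ?thesis
    by (simp add: power2_norm_eq_inner inner_add_left inner_add_right inner_commute algebra_simps)
qed

text \<open>In each coordinate the factor from \<open>Y\<close> is measurable for the subalgebra and
  can be pulled out of the conditional expectation; square integrability makes the products
  integrable.\<close>

lemma (in sigma_finite_subalgebra) integral_inner_eq_0_if_vec_cond_exp_eq_0:
  fixes Y W :: "'a \<Rightarrow> 'b::euclidean_space"
  assumes Y [measurable]: "Y \<in> borel_measurable F" and W [measurable]: "W \<in> borel_measurable M"
    and Y2: "integrable M (\<lambda>\<omega>. (norm (Y \<omega>))\<^sup>2)" and W2: "integrable M (\<lambda>\<omega>. (norm (W \<omega>))\<^sup>2)"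
    and 0: "AE \<omega> in M. vec_cond_exp M F W \<omega> = 0"
  shows "(\<integral>\<omega>. Y \<omega> \<bullet> W \<omega> \<partial>M) = 0"
proof -
  have [measurable]: "Y \<in> borel_measurable M"
    by (rule measurable_from_subalg[OF subalg Y])
  have coord: "integrable M (\<lambda>\<omega>. (Y \<omega> \<bullet> b) * (W \<omega> \<bullet> b))"
    "(\<integral>\<omega>. (Y \<omega> \<bullet> b) * (W \<omega> \<bullet> b) \<partial>M) = 0" if b: "b \<in> Basis" for b :: 'b
  proof -
    have bd: "(norm (v \<bullet> b))\<^sup>2 \<le> (norm v)\<^sup>2" for v
      using Basis_le_norm[OF b, of v] by (intro power_mono) auto
    have "integrable M (\<lambda>\<omega>. (norm (Y \<omega> \<bullet> b))\<^sup>2)"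
      by (rule Bochner_Integration.integrable_bound[OF Y2]) (use bd in auto)
    moreover have "integrable M (\<lambda>\<omega>. (norm (W \<omega> \<bullet> b))\<^sup>2)"
      by (rule Bochner_Integration.integrable_bound[OF W2]) (use bd in auto)
    ultimately have "integrable M (\<lambda>\<omega>. (Y \<omega> \<bullet> b) \<bullet> (W \<omega> \<bullet> b))"
      by (intro integrable_inner_square) auto
    then show int: "integrable M (\<lambda>\<omega>. (Y \<omega> \<bullet> b) * (W \<omega> \<bullet> b))"
      by simp
    have "AE \<omega> in M. real_cond_exp M F (\<lambda>\<omega>. W \<omega> \<bullet> b) \<omega> = 0"
      using 0
    proof eventually_elim
      case (elim \<omega>)
      then have "vec_cond_exp M F W \<omega> \<bullet> b = 0"
        by simp
      then show ?case
        using b by (simp add: vec_cond_exp_def inner_sum_left_Basis)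
    qed
    then have "AE \<omega> in M. (Y \<omega> \<bullet> b) * real_cond_exp M F (\<lambda>\<omega>. W \<omega> \<bullet> b) \<omega> = 0"
      by eventually_elim simp
    then have "(\<integral>\<omega>. (Y \<omega> \<bullet> b) * real_cond_exp M F (\<lambda>\<omega>. W \<omega> \<bullet> b) \<omega> \<partial>M) = 0"
      by (rule integral_eq_zero_AE)
    then show "(\<integral>\<omega>. (Y \<omega> \<bullet> b) * (W \<omega> \<bullet> b) \<partial>M) = 0"
      using real_cond_exp_intg(2)[OF int] by simp
  qed
  have "(\<integral>\<omega>. Y \<omega> \<bullet> W \<omega> \<partial>M) = (\<integral>\<omega>. (\<Sum>b\<in>Basis. (Y \<omega> \<bullet> b) * (W \<omega> \<bullet> b)) \<partial>M)"
    by (simp add: euclidean_inner[symmetric])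
  also have "\<dots> = 0"
    using coord by (subst Bochner_Integration.integral_sum) auto
  finally show ?thesis .
qed

text \<open>The nonnegative conditional expectation preserves the integral even when that is
  infinite, so the conditional bound yields integrability as well as the estimate.\<close>

lemma (in finite_measure_subalgebra) integral_le_if_nn_cond_exp_le:
  fixes f :: "'a \<Rightarrow> real"
  assumes prob: "prob_space M" and f [measurable]: "f \<in> borel_measurable M" "\<And>\<omega>. f \<omega> \<ge> 0"
    and le: "AE \<omega> in M. nn_cond_exp M F (\<lambda>\<omega>. ennreal (f \<omega>)) \<omega> \<le> ennreal c" and c: "c \<ge> 0"
  shows "integrable M f" "(\<integral>\<omega>. f \<omega> \<partial>M) \<le> c"
proof -
  interpret prob_space M by fact
  have "(\<integral>\<^sup>+ \<omega>. ennreal (f \<omega>) \<partial>M) = (\<integral>\<^sup>+ \<omega>. nn_cond_exp M F (\<lambda>\<omega>. ennreal (f \<omega>)) \<omega> \<partial>M)"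
    using nn_cond_exp_intg[of "\<lambda>_. 1" "\<lambda>\<omega>. ennreal (f \<omega>)"] by simp
  also have "\<dots> \<le> (\<integral>\<^sup>+ \<omega>. ennreal c \<partial>M)"
    by (rule nn_integral_mono_AE[OF le])
  finally have *: "(\<integral>\<^sup>+ \<omega>. ennreal (f \<omega>) \<partial>M) \<le> ennreal c"
    by (simp add: emeasure_space_1)
  show int: "integrable M f"
    using * f by (intro integrableI_nonneg) (auto intro: le_less_trans)
  have "ennreal (\<integral>\<omega>. f \<omega> \<partial>M) \<le> ennreal c"
    using * f by (subst nn_integral_eq_integral[OF int, symmetric]) auto
  then show "(\<integral>\<omega>. f \<omega> \<partial>M) \<le> c"
    using c by simp
qed

section \<open>The history and the noisy iteration\<close>

lemma subalgebra_history:
  assumes "\<And>i. x i \<in> borel_measurable M"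
  shows "subalgebra M (history M x k)"
proof -
  have "sets (history M x k) \<subseteq> sets M"
    unfolding history_def using assms
    by (subst sets_measure_of) (auto intro!: sets.sigma_sets_subset)
  then show ?thesis
    by (simp add: subalgebra_def history_def space_measure_of_conv)
qed

lemma measurable_history:
  assumes "i < k"
  shows "x i \<in> borel_measurable (history M x k)"
proof (rule measurableI)
  fix A :: "'b set" assume "A \<in> sets borel"
  then show "x i -` A \<inter> space (history M x k) \<in> sets (history M x k)"
    using assms unfolding history_def
    by (subst sets_measure_of) (auto simp: space_measure_of_conv intro!: sigma_sets.Basic)
qed simp

text \<open>The samples and \<open>G\<close> are hidden behind an abstract noise \<open>w\<close>,
  controlled through its conditional moments. Membership in \<open>X\<close> is assumed because a
  step does not project the iterate itself.\<close>

locale stochastic_ipg = inverse_vi X F \<mu> \<eta> xstar + prob_space M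
  for X :: "'a::euclidean_space set" and F \<mu> \<eta> xstar and M :: "'w measure" +
  fixes x w :: "nat \<Rightarrow> 'w \<Rightarrow> 'a" and x0 :: 'a and N :: "nat \<Rightarrow> nat" and \<nu> :: real
  assumes x_0: "\<And>\<omega>. \<omega> \<in> space M \<Longrightarrow> x 0 \<omega> = x0"
    and x_Suc: "\<And>k \<omega>. \<omega> \<in> space M \<Longrightarrow> x (Suc k) \<omega> = ipg_step (x k \<omega>) (w k \<omega>)"
    and x_in: "\<And>k \<omega>. \<omega> \<in> space M \<Longrightarrow> x k \<omega> \<in> X"
    and w_measurable [measurable]: "\<And>k. w k \<in> borel_measurable M"
    and unbiased: "\<And>k. AE \<omega> in M. vec_cond_exp M (history M x k) (w k) \<omega> = 0"
    and second_moment: "\<And>k. AE \<omega> in M.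
      nn_cond_exp M (history M x k) (\<lambda>\<omega>. ennreal ((norm (w k \<omega>))\<^sup>2)) \<omega> \<le> ennreal (\<nu>\<^sup>2 / real (N k))"
    and nu_pos: "\<nu> > 0"
begin

lemma x_measurable [measurable]: "x k \<in> borel_measurable M"
proof (induction k)
  case 0
  have "x 0 \<in> borel_measurable M \<longleftrightarrow> (\<lambda>_. x0) \<in> borel_measurable M"
    by (rule measurable_cong) (simp add: x_0)
  then show ?case by simp
next
  case (Suc k)
  note [measurable] = Suc
  define u where "u \<omega> = F (closest_point X (x k \<omega>)) + w k \<omega>" for \<omega>
  have [measurable]: "u \<in> borel_measurable M"
    unfolding u_def using measurable_compose[OF Suc borel_measurable_F] by measurable
  have "x (Suc k) \<in> borel_measurable M \<longleftrightarrow>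
      (\<lambda>\<omega>. x k \<omega> - (1 / \<eta>) *\<^sub>R (u \<omega> - closest_point X (u \<omega> - \<eta> *\<^sub>R x k \<omega>))) \<in> borel_measurable M"
    by (rule measurable_cong) (simp add: x_Suc ipg_step_def u_def closest_point_self x_in)
  also have "\<dots>"
    by measurable
  finally show ?case .
qed

lemma finite_measure_subalgebra_history: "finite_measure_subalgebra M (history M x k)"
  by (intro_locales)
     (simp add: finite_measure_subalgebra_axioms_def subalgebra_history)

lemma noise_second_moment:
  shows integrable_noise_square: "integrable M (\<lambda>\<omega>. (norm (w k \<omega>))\<^sup>2)"
    and expectation_noise_square_le: "expectation (\<lambda>\<omega>. (norm (w k \<omega>))\<^sup>2) \<le> \<nu>\<^sup>2 / real (N k)"
  using finite_measure_subalgebra.integral_le_if_nn_cond_exp_le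
    [OF finite_measure_subalgebra_history prob_space_axioms _ _ second_moment] by auto

lemma integrable_noise: "integrable M (\<lambda>\<omega>. norm (w k \<omega>))"
  using square_integrable_imp_integrable[of "\<lambda>\<omega>. norm (w k \<omega>)"] integrable_noise_square by simp

text \<open>Weighted Young inequality in place of Jensen; with the weight
  \<open>r / (2 * \<nu>)\<close> both summands are at most \<open>\<nu> / (2 * r)\<close>. Here
  \<open>r\<close> is a lower bound for the square root of the batch size.\<close>

lemma expectation_norm_noise_le:
  assumes r: "r > 0" "r\<^sup>2 \<le> real (N k)"
  shows "expectation (\<lambda>\<omega>. norm (w k \<omega>)) \<le> \<nu> / r"
proof -
  have "expectation (\<lambda>\<omega>. norm (w k \<omega>)) \<le> expectation (\<lambda>\<omega>. r / (2 * \<nu>) * (norm (w k \<omega>))\<^sup>2 + \<nu> / (2 * r))"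
  proof (rule integral_mono)
    show "norm (w k \<omega>) \<le> r / (2 * \<nu>) * (norm (w k \<omega>))\<^sup>2 + \<nu> / (2 * r)" for \<omega>
      using r(1) nu_pos sum_squares_bound[of "r * norm (w k \<omega>)" \<nu>]
      by (simp add: field_simps power2_eq_square)
  qed (use integrable_noise integrable_noise_square in auto)
  also have "\<dots> = r / (2 * \<nu>) * expectation (\<lambda>\<omega>. (norm (w k \<omega>))\<^sup>2) + \<nu> / (2 * r)"
    using integrable_noise_square[of k] by (simp add: prob_space)
  also have "\<dots> \<le> r / (2 * \<nu>) * (\<nu>\<^sup>2 / r\<^sup>2) + \<nu> / (2 * r)"
  proof -
    have "expectation (\<lambda>\<omega>. (norm (w k \<omega>))\<^sup>2) \<le> \<nu>\<^sup>2 / real (N k)"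
      by (rule expectation_noise_square_le)
    also have "\<dots> \<le> \<nu>\<^sup>2 / r\<^sup>2"
      using r by (intro divide_left_mono) (auto intro!: mult_pos_pos order_less_le_trans[of 0 "r\<^sup>2" "real (N k)"] simp del: of_nat_0_less_iff)
    finally show ?thesis
      using r nu_pos by (intro add_right_mono mult_left_mono) auto
  qed
  also have "\<dots> = \<nu> / r"
    using r nu_pos by (simp add: field_simps power2_eq_square)
  finally show ?thesis .
qed

lemma noise_step_ext_diff_le:
  assumes "\<omega> \<in> space M"
  shows "norm (x (Suc k) \<omega> - ext_step (x k \<omega>)) \<le> norm (w k \<omega>) / \<eta>"
  using assms by (simp add: x_Suc ext_step_eq x_in norm_ipg_step_noise_diff_le)

lemma integrable_ext_step_square:
  assumes [measurable]: "f \<in> borel_measurable M" and "integrable M (\<lambda>\<omega>. (norm (f \<omega>))\<^sup>2)"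
  shows "integrable M (\<lambda>\<omega>. (norm (ext_step (f \<omega>)))\<^sup>2)"
proof -
  have "integrable M (\<lambda>\<omega>. (norm ((ext_step (f \<omega>) - ext_step 0) + ext_step 0))\<^sup>2)"
  proof (rule integrable_square_norm_add)
    show "integrable M (\<lambda>\<omega>. (norm (ext_step (f \<omega>) - ext_step 0))\<^sup>2)"
      by (rule Bochner_Integration.integrable_bound[OF assms(2)])
         (use ext_step_nonexpansive[of _ 0] in \<open>auto intro!: power_mono\<close>)
  qed auto
  then show ?thesis by simp
qed

text \<open>By induction: the exact step is nonexpansive, and the noise moves its image by at most
  \<open>norm (w k \<omega>) / \<eta>\<close>.\<close>

lemma integrable_x_square: "integrable M (\<lambda>\<omega>. (norm (x k \<omega>))\<^sup>2)"
proof (induction k)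
  case 0
  have "integrable M (\<lambda>\<omega>. (norm (x 0 \<omega>))\<^sup>2) \<longleftrightarrow> integrable M (\<lambda>\<omega>. (norm x0)\<^sup>2)"
    by (rule Bochner_Integration.integrable_cong) (auto simp: x_0)
  then show ?case by simp
next
  case (Suc k)
  have "integrable M (\<lambda>\<omega>. (norm (ext_step (x k \<omega>) + (x (Suc k) \<omega> - ext_step (x k \<omega>))))\<^sup>2)"
  proof (rule integrable_square_norm_add)
    show "integrable M (\<lambda>\<omega>. (norm (ext_step (x k \<omega>)))\<^sup>2)"
      by (rule integrable_ext_step_square[OF _ Suc]) simp
    have "integrable M (\<lambda>\<omega>. (norm (w k \<omega>) / \<eta>)\<^sup>2)"
      using integrable_noise_square by (simp add: power_divide)
    then show "integrable M (\<lambda>\<omega>. (norm (x (Suc k) \<omega> - ext_step (x k \<omega>)))\<^sup>2)"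
      by (rule Bochner_Integration.integrable_bound)
         (use noise_step_ext_diff_le in \<open>auto intro!: power_mono AE_I2\<close>)
  qed auto
  then show ?case by simp
qed

lemma expectation_inner_noise_ge:
  shows "- expectation (\<lambda>\<omega>. ext_step (x k \<omega>) \<bullet> w k \<omega>)
    \<le> (if k = 0 then 0 else (\<nu>\<^sup>2 / real (N (k - 1)) + \<nu>\<^sup>2 / real (N k)) / (2 * \<eta>))"
proof -
  interpret H: finite_measure_subalgebra M "history M x k"
    by (rule finite_measure_subalgebra_history)
  show ?thesis
  proof (cases k)
    case 0
    \<comment> \<open>At \<open>k = 0\<close> the history is trivial, but the iterate is the
      constant \<open>x0\<close>, so no correction arises.\<close>
    have "expectation (\<lambda>\<omega>. ext_step (x k \<omega>) \<bullet> w k \<omega>) = expectation (\<lambda>\<omega>. ext_step x0 \<bullet> w k \<omega>)"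
      by (rule Bochner_Integration.integral_cong) (simp_all add: 0 x_0)
    also have "\<dots> = 0"
      by (rule H.integral_inner_eq_0_if_vec_cond_exp_eq_0)
         (auto intro: unbiased integrable_noise_square)
    finally show ?thesis by (simp add: 0)
  next
    case (Suc j)
    \<comment> \<open>The inner step predicts \<open>x k\<close> from \<open>x j\<close>. Since
      \<open>j < k\<close>, this surrogate is measurable for the history, unlike
      \<open>ext_step (x k \<omega>)\<close> in general.\<close>
    define Y where "Y \<omega> = ext_step (ext_step (x j \<omega>))" for \<omega>
    have "x j \<in> borel_measurable (history M x k)"
      by (rule measurable_history) (simp add: Suc)
    note [measurable] = this
    have YH: "Y \<in> borel_measurable (history M x k)"
      unfolding Y_def by measurable
    have [measurable]: "Y \<in> borel_measurable M"
      unfolding Y_def by measurable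
    have Y2: "integrable M (\<lambda>\<omega>. (norm (Y \<omega>))\<^sup>2)"
      unfolding Y_def by (intro integrable_ext_step_square integrable_x_square) simp_all
    have intY: "integrable M (\<lambda>\<omega>. Y \<omega> \<bullet> w k \<omega>)"
      by (intro integrable_inner_square Y2 integrable_noise_square) auto
    have intx: "integrable M (\<lambda>\<omega>. ext_step (x k \<omega>) \<bullet> w k \<omega>)"
      by (intro integrable_inner_square integrable_ext_step_square integrable_x_square
            integrable_noise_square) auto
    have Y0: "expectation (\<lambda>\<omega>. Y \<omega> \<bullet> w k \<omega>) = 0"
      by (rule H.integral_inner_eq_0_if_vec_cond_exp_eq_0[OF YH])
         (auto intro: unbiased integrable_noise_square Y2)
    have "- expectation (\<lambda>\<omega>. ext_step (x k \<omega>) \<bullet> w k \<omega>)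
        = expectation (\<lambda>\<omega>. (Y \<omega> - ext_step (x k \<omega>)) \<bullet> w k \<omega>)"
      using intY intx Y0 by (simp add: inner_diff_left)
    \<comment> \<open>The prediction error is at most \<open>norm (w j \<omega>) / \<eta>\<close>,
      and the outer step does not enlarge it; paired with \<open>w k\<close> it becomes a product of
      two noises.\<close>
    also have "\<dots> \<le> expectation (\<lambda>\<omega>. ((norm (w j \<omega>))\<^sup>2 + (norm (w k \<omega>))\<^sup>2) / (2 * \<eta>))"
    proof (rule integral_mono)
      show "integrable M (\<lambda>\<omega>. (Y \<omega> - ext_step (x k \<omega>)) \<bullet> w k \<omega>)"
        using intY intx by (simp add: inner_diff_left)
      show "integrable M (\<lambda>\<omega>. ((norm (w j \<omega>))\<^sup>2 + (norm (w k \<omega>))\<^sup>2) / (2 * \<eta>))"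
        using integrable_noise_square by simp
      fix \<omega> assume \<omega>: "\<omega> \<in> space M"
      have "norm (Y \<omega> - ext_step (x k \<omega>)) \<le> norm (w j \<omega>) / \<eta>"
        using ext_step_nonexpansive[of "ext_step (x j \<omega>)" "x k \<omega>"] noise_step_ext_diff_le[OF \<omega>, of j]
        by (simp add: Y_def Suc norm_minus_commute)
      then have "norm (Y \<omega> - ext_step (x k \<omega>)) * norm (w k \<omega>) \<le> norm (w j \<omega>) / \<eta> * norm (w k \<omega>)"
        by (rule mult_right_mono) simp
      also have "\<dots> \<le> ((norm (w j \<omega>))\<^sup>2 + (norm (w k \<omega>))\<^sup>2) / (2 * \<eta>)"
        using eta_pos sum_squares_bound[of "norm (w j \<omega>)" "norm (w k \<omega>)"] by (simp add: field_simps)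
      finally show "(Y \<omega> - ext_step (x k \<omega>)) \<bullet> w k \<omega> \<le> ((norm (w j \<omega>))\<^sup>2 + (norm (w k \<omega>))\<^sup>2) / (2 * \<eta>)"
        using norm_cauchy_schwarz[of "Y \<omega> - ext_step (x k \<omega>)" "w k \<omega>"] by linarith
    qed
    also have "\<dots> = (expectation (\<lambda>\<omega>. (norm (w j \<omega>))\<^sup>2) + expectation (\<lambda>\<omega>. (norm (w k \<omega>))\<^sup>2)) / (2 * \<eta>)"
      using integrable_noise_square by simp
    also have "\<dots> \<le> (\<nu>\<^sup>2 / real (N j) + \<nu>\<^sup>2 / real (N k)) / (2 * \<eta>)"
      using eta_pos by (intro divide_right_mono add_mono expectation_noise_square_le) auto
    finally show ?thesis by (simp add: Suc)
  qed
qed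

end

section \<open>Bounds for the two series\<close>

lemma powr_neg_diff_ge:
  fixes a \<delta> :: real
  assumes "a > 0" "\<delta> > 0"
  shows "\<delta> * (a + 1) powr (- (1 + \<delta>)) \<le> a powr (- \<delta>) - (a + 1) powr (- \<delta>)"
proof -
  \<comment> \<open>This and \<open>1 + u \<le> exp u\<close> give a Bernoulli inequality for
    \<open>(a / (a + 1)) powr (- \<delta>)\<close>, which is then scaled by
    \<open>(a + 1) powr (- \<delta>)\<close>.\<close>
  have "ln (a / (a + 1)) \<le> a / (a + 1) - 1"
    using assms by (intro ln_le_minus_one) simp
  also have "a / (a + 1) - 1 = - (1 / (a + 1))"
    using assms by (simp add: field_simps)
  finally have "\<delta> * (1 / (a + 1)) \<le> - \<delta> * ln (a / (a + 1))"
    using assms mult_left_mono[of "1 / (a + 1)" "- ln (a / (a + 1))" \<delta>] by simp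
  then have "1 + \<delta> / (a + 1) \<le> (a / (a + 1)) powr (- \<delta>)"
    using assms exp_ge_add_one_self[of "- \<delta> * ln (a / (a + 1))"] by (simp add: powr_def)
  then have "(a + 1) powr (- \<delta>) * (1 + \<delta> / (a + 1))
      \<le> (a + 1) powr (- \<delta>) * (a / (a + 1)) powr (- \<delta>)"
    by (rule mult_left_mono) simp
  also have "\<dots> = a powr (- \<delta>)"
    using assms by (subst powr_mult[symmetric]) auto
  also have "(a + 1) powr (- \<delta>) * (1 + \<delta> / (a + 1))
      = (a + 1) powr (- \<delta>) + \<delta> * (a + 1) powr (- (1 + \<delta>))"
  proof -
    have "- (1 + \<delta>) = - \<delta> - 1"
      by simp
    then have "(a + 1) powr (- (1 + \<delta>)) = (a + 1) powr (- \<delta>) / (a + 1)"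
      using assms by (simp only: powr_diff) simp
    then show ?thesis
      by (simp only: distrib_left) simp
  qed
  finally show ?thesis by simp
qed

text \<open>A discrete integral comparison: the first term is 1, and the later ones are dominated by
  differences that telescope to at most \<open>1 / \<delta>\<close>. The induction keeps the
  remainder \<open>real (n + 1) powr (- \<delta>) / \<delta>\<close>.\<close>

lemma sum_powr_le:
  fixes \<delta> :: real
  assumes "\<delta> > 0"
  shows "(\<Sum>k<T. real (k + 1) powr (- (1 + \<delta>))) \<le> 1 + 1 / \<delta>"
proof (cases T)
  case (Suc n)
  have "(\<Sum>k<Suc n. real (k + 1) powr (- (1 + \<delta>))) \<le> 1 + 1 / \<delta> - real (n + 1) powr (- \<delta>) / \<delta>"
  proof (induction n)
    case (Suc n)
    have "real (Suc n + 1) powr (- (1 + \<delta>))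
        \<le> (real (n + 1) powr (- \<delta>) - real (Suc n + 1) powr (- \<delta>)) / \<delta>"
      using powr_neg_diff_ge[of "real (n + 1)" \<delta>] assms by (simp add: field_simps)
    with Suc show ?case
      by (simp add: diff_divide_distrib)
  qed simp
  also have "\<dots> \<le> 1 + 1 / \<delta>"
    using assms by simp
  finally show ?thesis by (simp add: Suc)
qed (use assms in simp)

lemma sum_inverse_squares_le: "(\<Sum>k<T. 1 / (real k + 1)\<^sup>2) \<le> pi\<^sup>2 / 6"
proof -
  have "(\<lambda>k. 1 / (real k + 1)\<^sup>2) sums (pi\<^sup>2 / 6)"
    using inverse_squares_sums by (simp add: add.commute)
  then show ?thesis
    using sum_le_suminf[of "\<lambda>k. 1 / (real k + 1)\<^sup>2" "{..<T}"] by (simp add: sums_iff)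
qed

section \<open>Expected descent and its sum\<close>

context stochastic_ipg
begin

lemma gap_eq: "\<omega> \<in> space M \<Longrightarrow> gap X F (x k \<omega>) \<eta> = x k \<omega> - ext_step (x k \<omega>)"
  by (simp add: ext_step_eq x_in ipg_step_0)

lemma integrable_gap_square: "integrable M (\<lambda>\<omega>. (norm (gap X F (x k \<omega>) \<eta>))\<^sup>2)"
proof -
  have "integrable M (\<lambda>\<omega>. (norm (x k \<omega> + - ext_step (x k \<omega>)))\<^sup>2)"
    by (rule integrable_square_norm_add)
       (auto intro: integrable_x_square integrable_ext_step_square)
  then show ?thesis
    by (subst Bochner_Integration.integrable_cong[OF refl, where g = "\<lambda>\<omega>. (norm (x k \<omega> + - ext_step (x k \<omega>)))\<^sup>2"])
       (simp_all add: gap_eq)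
qed

lemma expected_sq_gap_eq:
  "expected_sq_gap M X F (x k) \<eta> = ennreal (expectation (\<lambda>\<omega>. (norm (gap X F (x k \<omega>) \<eta>))\<^sup>2))"
  unfolding expected_sq_gap_def by (rule nn_integral_eq_integral) (auto simp: integrable_gap_square)

lemma integrable_dist_square: "integrable M (\<lambda>\<omega>. (norm (x k \<omega> - xstar))\<^sup>2)"
  using integrable_square_norm_add[of "x k" M "\<lambda>_. - xstar"] integrable_x_square by simp

lemma expected_descent:
  assumes r: "r > 0" "r\<^sup>2 \<le> real (N k)"
  shows "expectation (\<lambda>\<omega>. (norm (x (Suc k) \<omega> - xstar))\<^sup>2)
      + (1 - 1 / (2 * \<eta> * \<mu>)) * expectation (\<lambda>\<omega>. (norm (gap X F (x k \<omega>) \<eta>))\<^sup>2)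
    \<le> expectation (\<lambda>\<omega>. (norm (x k \<omega> - xstar))\<^sup>2)
      + \<nu>\<^sup>2 / \<eta>\<^sup>2 * (2 / real (N k) + (if k = 0 then 0 else 1 / real (N (k - 1))))
      + 2 * \<nu> * norm xstar / \<eta> * (1 / r)"
proof -
  let ?c = "1 - 1 / (2 * \<eta> * \<mu>)"
  have intx: "integrable M (\<lambda>\<omega>. ext_step (x k \<omega>) \<bullet> w k \<omega>)"
    by (intro integrable_inner_square integrable_ext_step_square integrable_x_square
          integrable_noise_square) auto
  note int = integrable_dist_square integrable_gap_square integrable_noise_square integrable_noise intx
  have "expectation (\<lambda>\<omega>. (norm (x (Suc k) \<omega> - xstar))\<^sup>2)
      + ?c * expectation (\<lambda>\<omega>. (norm (gap X F (x k \<omega>) \<eta>))\<^sup>2)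
    = expectation (\<lambda>\<omega>. (norm (x (Suc k) \<omega> - xstar))\<^sup>2 + ?c * (norm (gap X F (x k \<omega>) \<eta>))\<^sup>2)"
    using int by simp
  also have "\<dots> \<le> expectation (\<lambda>\<omega>. (norm (x k \<omega> - xstar))\<^sup>2 - 2 / \<eta> * (ext_step (x k \<omega>) \<bullet> w k \<omega>)
      + 1 / \<eta>\<^sup>2 * (norm (w k \<omega>))\<^sup>2 + 2 * norm xstar / \<eta> * norm (w k \<omega>))"
  proof (rule integral_mono)
    fix \<omega> assume "\<omega> \<in> space M"
    then show "(norm (x (Suc k) \<omega> - xstar))\<^sup>2 + ?c * (norm (gap X F (x k \<omega>) \<eta>))\<^sup>2
        \<le> (norm (x k \<omega> - xstar))\<^sup>2 - 2 / \<eta> * (ext_step (x k \<omega>) \<bullet> w k \<omega>)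
          + 1 / \<eta>\<^sup>2 * (norm (w k \<omega>))\<^sup>2 + 2 * norm xstar / \<eta> * norm (w k \<omega>)"
      using ipg_step_descent[OF x_in, of \<omega> k "w k \<omega>"] by (simp add: x_Suc ext_step_eq x_in)
  qed (use int in simp_all)
  also have "\<dots> = expectation (\<lambda>\<omega>. (norm (x k \<omega> - xstar))\<^sup>2)
      + 2 / \<eta> * - expectation (\<lambda>\<omega>. ext_step (x k \<omega>) \<bullet> w k \<omega>)
      + 1 / \<eta>\<^sup>2 * expectation (\<lambda>\<omega>. (norm (w k \<omega>))\<^sup>2)
      + 2 * norm xstar / \<eta> * expectation (\<lambda>\<omega>. norm (w k \<omega>))"
    using int by simp
  also have "\<dots> \<le> expectation (\<lambda>\<omega>. (norm (x k \<omega> - xstar))\<^sup>2)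
      + 2 / \<eta> * (if k = 0 then 0 else (\<nu>\<^sup>2 / real (N (k - 1)) + \<nu>\<^sup>2 / real (N k)) / (2 * \<eta>))
      + 1 / \<eta>\<^sup>2 * (\<nu>\<^sup>2 / real (N k)) + 2 * norm xstar / \<eta> * (\<nu> / r)"
    using eta_pos
    by (intro add_mono mult_left_mono expectation_inner_noise_ge expectation_noise_square_le
          expectation_norm_noise_le r) auto
  \<comment> \<open>For \<open>k = 0\<close> the left side vanishes; the spare
    \<open>1 / real (N k)\<close> keeps the bound uniform. With the quadratic term it makes up the
    coefficient 2.\<close>
  also have "2 / \<eta> * (if k = 0 then 0 else (\<nu>\<^sup>2 / real (N (k - 1)) + \<nu>\<^sup>2 / real (N k)) / (2 * \<eta>))
      \<le> \<nu>\<^sup>2 / \<eta>\<^sup>2 * (1 / real (N k) + (if k = 0 then 0 else 1 / real (N (k - 1))))"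
    using eta_pos by (cases "k = 0") (simp_all add: power2_eq_square distrib_left add_divide_distrib mult_ac)
  finally show ?thesis
    by (simp add: algebra_simps)
qed

lemma sum_expected_gap_le:
  assumes "\<delta> > 0" and N: "\<And>k. real (k + 1) powr (2 + 2 * \<delta>) \<le> real (N k)"
  shows "(1 - 1 / (2 * \<eta> * \<mu>)) * (\<Sum>k<T. expectation (\<lambda>\<omega>. (norm (gap X F (x k \<omega>) \<eta>))\<^sup>2))
    \<le> (norm (x0 - xstar))\<^sup>2 + pi\<^sup>2 * \<nu>\<^sup>2 / \<eta>\<^sup>2 + 2 * \<nu> * norm xstar / \<eta> * (1 + 1 / \<delta>)"
proof -
  let ?c = "1 - 1 / (2 * \<eta> * \<mu>)"
  let ?g = "\<lambda>k. expectation (\<lambda>\<omega>. (norm (gap X F (x k \<omega>) \<eta>))\<^sup>2)"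
  define e where "e k = expectation (\<lambda>\<omega>. (norm (x k \<omega> - xstar))\<^sup>2)" for k
  define s where "s k = 1 / (real k + 1)\<^sup>2" for k
  define b where "b k = \<nu>\<^sup>2 / \<eta>\<^sup>2 * (2 * s k + (if k = 0 then 0 else s (k - 1)))
    + 2 * \<nu> * norm xstar / \<eta> * real (k + 1) powr (- (1 + \<delta>))" for k
  \<comment> \<open>The quadratic noise terms use only the exponent 2 of the batch size; the extra
    \<open>2 * \<delta>\<close> serves the first-order term.\<close>
  have N2: "1 / real (N k) \<le> s k" for k
  proof -
    have "(real k + 1)\<^sup>2 = real (k + 1) powr 2"
      by (simp add: powr_numeral add.commute)
    also have "\<dots> \<le> real (k + 1) powr (2 + 2 * \<delta>)"
      using assms by (intro powr_mono) auto
    finally have "(real k + 1)\<^sup>2 \<le> real (N k)"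
      using N[of k] by linarith
    then show ?thesis
      unfolding s_def by (intro frac_le) auto
  qed
  have desc: "?c * ?g k \<le> e k - e (Suc k) + b k" for k
  proof -
    \<comment> \<open>The square root of the lower bound for \<open>N k\<close>.\<close>
    let ?r = "real (k + 1) powr (1 + \<delta>)"
    have "?r\<^sup>2 = real (k + 1) powr (2 + 2 * \<delta>)"
      by (simp add: power2_eq_square algebra_simps flip: powr_add)
    then have "e (Suc k) + ?c * ?g k \<le> e k
        + \<nu>\<^sup>2 / \<eta>\<^sup>2 * (2 / real (N k) + (if k = 0 then 0 else 1 / real (N (k - 1))))
        + 2 * \<nu> * norm xstar / \<eta> * (1 / ?r)"
      unfolding e_def using N[of k] by (intro expected_descent) auto
    also have "\<nu>\<^sup>2 / \<eta>\<^sup>2 * (2 / real (N k) + (if k = 0 then 0 else 1 / real (N (k - 1))))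
        \<le> \<nu>\<^sup>2 / \<eta>\<^sup>2 * (2 * s k + (if k = 0 then 0 else s (k - 1)))"
      using N2[of k] N2[of "k - 1"] by (intro mult_left_mono add_mono) auto
    finally show ?thesis
      unfolding b_def powr_minus_divide by linarith
  qed
  have tel: "?c * (\<Sum>k<T. ?g k) \<le> e 0 - e T + (\<Sum>k<T. b k)"
    using sum_mono[of "{..<T}" "\<lambda>k. ?c * ?g k" "\<lambda>k. e k - e (Suc k) + b k"] desc
    by (simp add: sum_distrib_left sum.distrib sum_lessThan_telescope')
  have s0: "s k \<ge> 0" for k by (simp add: s_def)
  have shift: "(\<Sum>k<T. if k = 0 then 0 else s (k - 1)) \<le> pi\<^sup>2 / 6"
  proof (cases T)
    case (Suc n)
    have "(\<Sum>k<T. if k = 0 then 0 else s (k - 1)) = (\<Sum>k<n. s k)"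
      unfolding Suc by (subst sum.lessThan_Suc_shift) simp
    then show ?thesis
      using sum_inverse_squares_le[of n] by (simp add: s_def)
  qed simp
  have "(\<Sum>k<T. b k) = \<nu>\<^sup>2 / \<eta>\<^sup>2 * (2 * (\<Sum>k<T. s k) + (\<Sum>k<T. if k = 0 then 0 else s (k - 1)))
      + 2 * \<nu> * norm xstar / \<eta> * (\<Sum>k<T. real (k + 1) powr (- (1 + \<delta>)))"
    unfolding b_def by (simp only: sum.distrib flip: sum_distrib_left)
  \<comment> \<open>Three Basel sums, one of them shifted by an index, total
    \<open>pi\<^sup>2 / 2\<close>; the next line rounds this up to the stated constant.\<close>
  also have "\<dots> \<le> \<nu>\<^sup>2 / \<eta>\<^sup>2 * (2 * (pi\<^sup>2 / 6) + pi\<^sup>2 / 6) + 2 * \<nu> * norm xstar / \<eta> * (1 + 1 / \<delta>)"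
    using eta_pos nu_pos shift sum_inverse_squares_le[of T, folded s_def]
    by (intro add_mono mult_left_mono sum_powr_le assms) auto
  also have "\<dots> \<le> \<nu>\<^sup>2 / \<eta>\<^sup>2 * pi\<^sup>2 + 2 * \<nu> * norm xstar / \<eta> * (1 + 1 / \<delta>)"
    by (intro add_right_mono mult_left_mono) auto
  finally have "(\<Sum>k<T. b k) \<le> pi\<^sup>2 * \<nu>\<^sup>2 / \<eta>\<^sup>2 + 2 * \<nu> * norm xstar / \<eta> * (1 + 1 / \<delta>)"
    by (simp add: algebra_simps)
  moreover have "e T \<ge> 0"
    by (simp add: e_def)
  moreover have "e 0 = expectation (\<lambda>\<omega>. (norm (x0 - xstar))\<^sup>2)"
    unfolding e_def by (rule Bochner_Integration.integral_cong) (simp_all add: x_0)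
  then have "e 0 = (norm (x0 - xstar))\<^sup>2"
    by (simp add: prob_space)
  ultimately show ?thesis
    using tel by linarith
qed

end

section \<open>The best-iterate bound for the batched method\<close>

lemma batch_mean_eq:
  assumes "N k > 0"
  shows "batch_mean G N s k (x k \<omega>) \<omega> = F (x k \<omega>) + sampling_error F G N s x k \<omega>"
  using assms by (simp add: batch_mean_def sampling_error_def sum_subtractf scaleR_diff_right
      sum_constant_scaleR)

theorem theorem2:
  fixes M :: "'w measure"
    and X :: "'a::euclidean_space set"
    and G :: "'a \<Rightarrow> 'b::euclidean_space \<Rightarrow> 'a"
    and F :: "'a \<Rightarrow> 'a"
    and \<xi> :: "'w \<Rightarrow> 'b"
    and s :: "nat \<Rightarrow> nat \<Rightarrow> 'w \<Rightarrow> 'b"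
    and x :: "nat \<Rightarrow> 'w \<Rightarrow> 'a"
    and x0 xstar :: 'a
    and N :: "nat \<Rightarrow> nat"
    and \<mu> \<nu> \<eta> \<delta> :: real
  assumes "prob_space M"
    and "X \<noteq> {}" "closed X" "convex X"
    and "\<xi> \<in> borel_measurable M"
    and G_integrable: "\<forall>y\<in>X. integrable M (\<lambda>\<omega>. G y (\<xi> \<omega>))"
    and F: "\<forall>y\<in>X. F y = prob_space.expectation M (\<lambda>\<omega>. G y (\<xi> \<omega>))"
    and "continuous_on X F"
    and cocoercive: "cocoercive_on X F \<mu>"
    and solution: "xstar \<in> X" "sivi_solution X F xstar"
    and samples: "\<forall>k. \<forall>j\<in>{1..N k}. s j k \<in> borel_measurable M \<and>
                    distr M borel (s j k) = distr M borel \<xi>"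
    and "x0 \<in> X"
    and iterates: "x = vr_ipg X G (\<lambda>_. \<eta>) N s x0"
    and iterates_in_domain: "\<forall>k. \<forall>\<omega>\<in>space M. x k \<omega> \<in> X"
    and error_measurable: "\<forall>k. sampling_error F G N s x k \<in> borel_measurable M"
    and "\<nu> > 0"
    and unbiased: "\<forall>k. AE \<omega> in M. vec_cond_exp M (history M x k) (sampling_error F G N s x k) \<omega> = 0"
    and second_moment: "\<forall>k. AE \<omega> in M.
          nn_cond_exp M (history M x k) (\<lambda>\<omega>. ennreal ((norm (sampling_error F G N s x k \<omega>))\<^sup>2)) \<omega>
            \<le> ennreal (\<nu>\<^sup>2 / real (N k))"
    and step: "\<eta> \<ge> 1 / (2 * \<mu>)"
    and "\<delta> > 0"
    and batch: "\<forall>k. N k = nat \<lceil>real (k + 1) powr (2 + 2 * \<delta>)\<rceil>"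
  shows "(\<forall>T\<ge>1. (MIN k\<in>{..<T}. expected_sq_gap M X F (x k) \<eta>)
            \<le> 1 / ennreal (real T * (1 - 1 / (2 * \<eta> * \<mu>)))
               * ennreal ((norm (x0 - xstar))\<^sup>2 + pi\<^sup>2 * \<nu>\<^sup>2 / \<eta>\<^sup>2
                          + 2 * \<nu> * norm xstar / \<eta> * (1 + 1 / \<delta>)))
       \<and> (\<eta> > 1 / (2 * \<mu>) \<longrightarrow>
            (\<lambda>T. enn2real (MIN k\<in>{..<T}. expected_sq_gap M X F (x k) \<eta>)) \<in> O(\<lambda>T. 1 / real T))"
proof -
  let ?w = "sampling_error F G N s x"
  define B where "B = (norm (x0 - xstar))\<^sup>2 + pi\<^sup>2 * \<nu>\<^sup>2 / \<eta>\<^sup>2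
    + 2 * \<nu> * norm xstar / \<eta> * (1 + 1 / \<delta>)"
  define c where "c = 1 - 1 / (2 * \<eta> * \<mu>)"
  interpret inverse_vi X F \<mu> \<eta> xstar
    by unfold_locales (use assms in auto)
  have N: "real (k + 1) powr (2 + 2 * \<delta>) \<le> real (N k)" for k
    using batch by (simp add: real_nat_ceiling_ge)
  \<comment> \<open>An empty batch has batch mean and sampling error zero, so splitting the batch
    mean into \<open>F\<close> plus noise requires a positive size.\<close>
  have N_pos: "N k > 0" for k
  proof -
    have "0 < real (k + 1) powr (2 + 2 * \<delta>)"
      by simp
    also note N[of k]
    finally show ?thesis by simp
  qed
  interpret stochastic_ipg X F \<mu> \<eta> xstar M x ?w x0 N \<nu>
  proof (intro stochastic_ipg.intro stochastic_ipg_axioms.intro)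
    show "x (Suc k) \<omega> = ipg_step (x k \<omega>) (?w k \<omega>)" for k \<omega>
      unfolding ipg_step_def batch_mean_eq[of N k G s x \<omega> F, OF N_pos, symmetric]
      by (simp add: iterates Let_def)
  qed (use assms inverse_vi_axioms in \<open>simp_all\<close>)
  have bound: "(MIN k\<in>{..<T}. expected_sq_gap M X F (x k) \<eta>) \<le> ennreal (B / (real T * c))"
    if "T \<ge> 1" "c > 0" for T
  proof -
    let ?g = "\<lambda>k. expectation (\<lambda>\<omega>. (norm (gap X F (x k \<omega>) \<eta>))\<^sup>2)"
    \<comment> \<open>Some term is no larger than the average of the \<open>T\<close> terms.\<close>
    have "\<exists>k<T. ?g k \<le> B / (real T * c)"
    proof (rule ccontr)
      assume "\<not> ?thesis"
      then have "(\<Sum>k<T. B / (real T * c)) < (\<Sum>k<T. ?g k)"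
        using that by (intro sum_strict_mono) (auto simp: not_le lessThan_empty_iff)
      then have "B < c * (\<Sum>k<T. ?g k)"
        using that by (simp add: field_simps)
      then show False
        using sum_expected_gap_le[OF \<open>\<delta> > 0\<close> N, of T] by (simp add: B_def c_def)
    qed
    then obtain k where k: "k < T" "?g k \<le> B / (real T * c)"
      by blast
    have "(MIN k\<in>{..<T}. expected_sq_gap M X F (x k) \<eta>) \<le> expected_sq_gap M X F (x k) \<eta>"
      using k by (intro Min_le) auto
    also have "\<dots> \<le> ennreal (B / (real T * c))"
      using k by (simp add: expected_sq_gap_eq ennreal_leI)
    finally show ?thesis .
  qed
  \<comment> \<open>Strictness matters when \<open>c = 0\<close>, that is
    \<open>\<eta> = 1 / (2 * \<mu>)\<close>: the right-hand side is then infinity times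
    \<open>B\<close>, which is infinite only for \<open>B\<close> nonzero.\<close>
  have B_pos: "B > 0"
    unfolding B_def using eta_pos \<open>\<nu> > 0\<close> \<open>\<delta> > 0\<close>
    by (intro add_pos_nonneg add_nonneg_pos) auto
  have c_nonneg: "c \<ge> 0"
    using step mu_pos eta_pos by (simp add: c_def field_simps)
  have "(MIN k\<in>{..<T}. expected_sq_gap M X F (x k) \<eta>) \<le> 1 / ennreal (real T * c) * ennreal B"
    if T: "T \<ge> 1" for T
  proof (cases "c = 0")
    case True
    then show ?thesis
      using B_pos by (simp add: ennreal_top_mult)
  next
    case False
    then have "1 / ennreal (real T * c) * ennreal B = ennreal (B / (real T * c))"
      using c_nonneg T B_pos
      by (simp add: divide_ennreal ennreal_mult[symmetric] flip: ennreal_1)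
    then show ?thesis
      using bound[OF T] c_nonneg False by simp
  qed
  moreover have "(\<lambda>T. enn2real (MIN k\<in>{..<T}. expected_sq_gap M X F (x k) \<eta>)) \<in> O(\<lambda>T. 1 / real T)"
    if "\<eta> > 1 / (2 * \<mu>)"
  proof (rule bigoI[where c = "B / c"])
    have c: "c > 0"
      using that mu_pos eta_pos by (simp add: c_def field_simps)
    show "\<forall>\<^sub>F T in sequentially. norm (enn2real (MIN k\<in>{..<T}. expected_sq_gap M X F (x k) \<eta>))
        \<le> B / c * norm (1 / real T)"
      \<comment> \<open>Leaves out \<open>T = 0\<close>, where the minimum ranges over the empty
        set.\<close>
      using eventually_ge_at_top[of 1]
    proof eventually_elim
      case (elim T)
      then show ?case
        using enn2real_mono[OF bound[OF elim c]] B_pos c by (simp add: mult.commute)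
    qed
  qed
  ultimately show ?thesis
    unfolding B_def c_def by blast
qed

end
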